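(* Consider the F-RAN system described in the context, with fractional cache size $\mu\in[1/K_T,1]$ and fronthaul rate $r=0$. Then the minimum NDT (serial fronthaul-edge transmission) satisfies $$\delta^*(\mu,0)\le \delta_E(m(\mu)),\qquad \delta_E(m)=\frac{K_R}{u(m)},\qquad u(m)=\min\{m n_T,K_R\},$$ where $m(\mu)=\min\{\lfloor \mu K_T\rfloor, m_{max}\}$ and $m_{max}=\min\{K_T,\lceil K_R/n_T\rceil\}$.
   Context: F-RAN model. $K_T,K_R,n_T\ge 1$ and $N\ge K_R$ are integers; $[K]=\{1,\dots,K\}$. There are $K_T$ edge nodes (ENs) with $n_T$ antennas each, $K_R$ single-antenna users, and a cloud with a library of $N$ files $W_1,\dots,W_N$ of equal size. Each file is split into $F\ge 1$ equal packets, $\mathcal W_n=\{W_{n1},\dots,W_{nF}\}$ ($F$ is a free design parameter). $\mu\in[0,1]$ is the fractional cache size and $r\ge 0$ the fronthaul rate (each fronthaul link has capacity $r\log P$ bits per channel use, $P$ = SNR). Caching: EN $i$ stores sets $\mathcal C_{in}\subseteq\mathcal W_n$ with $|\mathcal C_{in}|\le \mu F$ for every $n$, chosen before the requests are known; $\mathcal C_i=\bigcup_n\mathcal C_{in}$. Delivery: user $k$ requests file $d_k\in[N]$; $\boldsymbol d=(d_1,\dots,d_{K_R})$. The cloud sends to EN $i$ a set $\mathcal F_i$ of (uncoded) packets of requested files. Then edge transmission takes place in $B$ blocks by one-shot linear precoding: in each block $b$ a set $\mathcal R(b)\subseteq[K_R]$ of users is served, each $k\in\mathcal R(b)$ with exactly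 one packet of $W_{d_k}$; the stream for user $k$ is sent with precoding vectors $\boldsymbol v_{i,k}\in\mathbb C^{n_T}$ by those ENs $i$ whose set $\mathcal C_i\cup\mathcal F_i$ contains that packet (the other ENs use $\boldsymbol v_{i,k}=0$); decodability without interference means $\sum_i \boldsymbol h_{ki}^T\boldsymbol v_{i,k}\ne 0$ and $\sum_i \boldsymbol h_{k'i}^T\boldsymbol v_{i,k}=0$ for all $k'\in\mathcal R(b)\setminus\{k\}$, where $\boldsymbol h_{ki}=\boldsymbol h_{ki}(b)\in\mathbb C^{n_T}$ is the channel from EN $i$ to user $k$. After the $B$ blocks every user must have received all $F$ packets of its file. The fronthaul sets and the edge transmission may depend on $\boldsymbol d$ and on the channels. The channels are arbitrary but non-degenerate: in each block, every square submatrix of the $K_R\times K_Tn_T$ matrix with rows $(\boldsymbol h_{k1}^T,\dots,\boldsymbol h_{kK_T}^T)$ is invertible. NDT (serial mode): for a policy and request $\boldsymbol d$, the fronthaul NDT is $\max_i|\mathcal F_i|/(Fr)$ (if $r=0$, nothing may be sent on the fronthaul and this is $0$), the edge NDT is $B/F$, and the NDT of the policy is the maximum over $\boldsymbol d$ of their sum. $\bar\delta(\mu,r)$ is the infimum of the NDT over all $F\ge1$ and all policies ($+\infty$ if there is none), and the minimum NDT $\delta^*(\mu,r)$ is the lower convex envelope of $\bar\delta(\mu,r)$ as a function of $\mu\in[0,1]$ for fixed $r$. *)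

theory Defs
  imports "HOL-Analysis.Convex" "HOL-Library.Extended_Real" "Jordan_Normal_Form.DL_Submatrix"
begin

text \<open>
  All index sets are 0-based: edge nodes (ENs) \<open>i < K_T\<close>, users \<open>k < K_R\<close>, files \<open>n < N\<close>,
  antennas \<open>a < n_T\<close>, transmission blocks \<open>b < B\<close>.
\<close>

type_synonym packet = "nat \<times> nat"  \<comment> \<open>file index, index of the packet within the file\<close>
type_synonym request = "nat \<Rightarrow> nat"  \<comment> \<open>user \<open>k\<close> requests the file \<open>d k\<close>\<close>

text \<open>\<open>h b k i\<close> is the channel vector from EN \<open>i\<close> to user \<open>k\<close> in block \<open>b\<close>. Channels are given for
  all \<open>b\<close>, since the number of blocks used is chosen by the policy.\<close>
type_synonym channel = "nat \<Rightarrow> nat \<Rightarrow> nat \<Rightarrow> complex vec"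

record delivery =
  fronthaul :: "nat \<Rightarrow> packet set"
  blocks :: nat
  served :: "nat \<Rightarrow> nat set"  \<comment> \<open>block \<open>b\<close> \<open>\<mapsto>\<close> set of users \<open>R(b)\<close>\<close>
  sent :: "nat \<Rightarrow> nat \<Rightarrow> packet"  \<comment> \<open>block \<open>b\<close>, user \<open>k\<close>\<close>
  precoder :: "nat \<Rightarrow> nat \<Rightarrow> nat \<Rightarrow> complex vec"  \<comment> \<open>block \<open>b\<close>, EN \<open>i\<close>, user \<open>k\<close>\<close>

text \<open>The caches depend neither on the requests nor on the channels; the delivery depends on both.\<close>
record policy =
  packets_per_file :: nat
  cache :: "nat \<Rightarrow> nat \<Rightarrow> packet set"  \<comment> \<open>EN \<open>i\<close>, file \<open>n\<close>\<close>
  deliver :: "request \<Rightarrow> channel \<Rightarrow> delivery"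

definition file_packets :: "nat \<Rightarrow> nat \<Rightarrow> packet set" where
  "file_packets F n = {n} \<times> {..<F}"

text \<open>Lower convex envelope on \<open>S\<close>: the lower boundary of the convex hull of the epigraph, for
  functions that may take infinite values.\<close>
definition lower_convex_envelope :: "real set \<Rightarrow> (real \<Rightarrow> ereal) \<Rightarrow> real \<Rightarrow> ereal" where
  "lower_convex_envelope S f x =
     (INF y \<in> {y. (x, y) \<in> convex hull {(a, z). a \<in> S \<and> f a \<le> ereal z}}. ereal y)"

locale f_ran =
  fixes K_T K_R n_T N :: nat
begin

definition requests :: "request set" where
  "requests = {..<K_R} \<rightarrow>\<^sub>E {..<N}"

definition channel_matrix :: "(nat \<Rightarrow> nat \<Rightarrow> complex vec) \<Rightarrow> complex mat" where
  "channel_matrix g =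
     mat K_R (K_T * n_T) (\<lambda>(k, j). vec_index (g k (j div n_T)) (j mod n_T))"

definition channels :: "channel set" where
  "channels = {h. \<forall>b.
     (\<forall>k<K_R. \<forall>i<K_T. h b k i \<in> carrier_vec n_T) \<and>
     (\<forall>I J. I \<subseteq> {..<K_R} \<longrightarrow> J \<subseteq> {..<K_T * n_T} \<longrightarrow> card I = card J \<longrightarrow>
        invertible_mat (submatrix (channel_matrix (h b)) I J))}"

definition valid_cache :: "real \<Rightarrow> nat \<Rightarrow> (nat \<Rightarrow> nat \<Rightarrow> packet set) \<Rightarrow> bool" where
  "valid_cache \<mu> F C \<longleftrightarrow>
     (\<forall>i<K_T. \<forall>n<N. C i n \<subseteq> file_packets F n \<and> real (card (C i n)) \<le> \<mu> * real F)"

definition available :: "(nat \<Rightarrow> nat \<Rightarrow> packet set) \<Rightarrow> delivery \<Rightarrow> nat \<Rightarrow> packet set" where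
  "available C D i = (\<Union>n<N. C i n) \<union> fronthaul D i"

definition valid_delivery ::
  "real \<Rightarrow> nat \<Rightarrow> (nat \<Rightarrow> nat \<Rightarrow> packet set) \<Rightarrow> request \<Rightarrow> channel \<Rightarrow> delivery \<Rightarrow> bool" where
  "valid_delivery r F C d h D \<longleftrightarrow>
     (\<forall>i<K_T. fronthaul D i \<subseteq> (\<Union>k<K_R. file_packets F (d k)) \<and>
        (r = 0 \<longrightarrow> fronthaul D i = {})) \<and>
     (\<forall>b<blocks D. served D b \<subseteq> {..<K_R} \<and>
        (\<forall>k\<in>served D b.
           sent D b k \<in> file_packets F (d k) \<and>
           (\<forall>i<K_T. precoder D b i k \<in> carrier_vec n_T \<and>
              (sent D b k \<notin> available C D i \<longrightarrow> precoder D b i k = 0\<^sub>v n_T)) \<and>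
           (\<Sum>i<K_T. scalar_prod (h b k i) (precoder D b i k)) \<noteq> 0 \<and>
           (\<forall>k'\<in>served D b - {k}.
              (\<Sum>i<K_T. scalar_prod (h b k' i) (precoder D b i k)) = 0))) \<and>
     (\<forall>k<K_R. \<forall>p\<in>file_packets F (d k). \<exists>b<blocks D. k \<in> served D b \<and> sent D b k = p)"

definition valid_policy :: "real \<Rightarrow> real \<Rightarrow> policy \<Rightarrow> bool" where
  "valid_policy \<mu> r P \<longleftrightarrow>
     packets_per_file P \<ge> 1 \<and>
     valid_cache \<mu> (packets_per_file P) (cache P) \<and>
     (\<forall>d\<in>requests. \<forall>h\<in>channels.
        valid_delivery r (packets_per_file P) (cache P) d h (deliver P d h))"

definition fronthaul_NDT :: "real \<Rightarrow> nat \<Rightarrow> delivery \<Rightarrow> real" where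
  "fronthaul_NDT r F D =
     (if r = 0 then 0 else real (MAX i\<in>{..<K_T}. card (fronthaul D i)) / (real F * r))"

definition edge_NDT :: "nat \<Rightarrow> delivery \<Rightarrow> real" where
  "edge_NDT F D = real (blocks D) / real F"

text \<open>Worst case over the requests and over all non-degenerate channels.\<close>
definition policy_NDT :: "real \<Rightarrow> policy \<Rightarrow> ereal" where
  "policy_NDT r P =
     (SUP d\<in>requests. SUP h\<in>channels.
        ereal (fronthaul_NDT r (packets_per_file P) (deliver P d h) +
               edge_NDT (packets_per_file P) (deliver P d h)))"

definition NDT_bar :: "real \<Rightarrow> real \<Rightarrow> ereal" where
  "NDT_bar \<mu> r = (INF P\<in>{P. valid_policy \<mu> r P}. policy_NDT r P)"

definition min_NDT :: "real \<Rightarrow> real \<Rightarrow> ereal" where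
  "min_NDT \<mu> r = lower_convex_envelope {0..1} (\<lambda>\<mu>'. NDT_bar \<mu>' r) \<mu>"

definition m_max :: nat where
  "m_max = min K_T (nat \<lceil>real K_R / real n_T\<rceil>)"

definition multiplicity_at :: "real \<Rightarrow> nat" where
  "multiplicity_at \<mu> = min (nat \<lfloor>\<mu> * real K_T\<rfloor>) m_max"

definition users_per_block :: "nat \<Rightarrow> nat" where
  "users_per_block m = min (m * n_T) K_R"

definition delta_E :: "nat \<Rightarrow> real" where
  "delta_E m = real K_R / real (users_per_block m)"

end

end

theory Submission
  imports Defs
begin

text \<open>
  Let \<open>m\<close> be the caching multiplicity and \<open>u = min (m n_T) K_R\<close>. Split every file into \<open>K_T u\<close> packets,
  grouped into \<open>K_T\<close> runs of length \<open>u\<close>, and cache run \<open>q\<close> at the \<open>m\<close> cyclically consecutive ENs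
  \<open>i\<close> with \<open>(q + i) mod K_T < m\<close>. Use \<open>K_T K_R\<close> blocks, \<open>K_R\<close> per run: a cyclic window of \<open>u\<close> users
  moves once around all users, so that each user is served \<open>u\<close> times per run. The \<open>m\<close> ENs
  holding a run have \<open>m n_T \<ge> u\<close> antennas, so the invertibility of a \<open>u \<times> u\<close> submatrix of the channel
  gives zero-forcing precoders. The edge NDT is \<open>K_T K_R / (K_T u) = K_R / u\<close>.
\<close>

section \<open>Cyclic shifts and windows of residues\<close>

lemma bij_betw_add_mod:
  fixes c n :: nat
  shows "bij_betw (\<lambda>x. (x + c) mod n) {..<n} {..<n}"
proof -
  have inj: "inj_on (\<lambda>x. (x + c) mod n) {..<n}"
  proof (rule linorder_inj_onI')
    fix x y assume xy: "x \<in> {..<n}" "y \<in> {..<n}" "x < y"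
    show "(x + c) mod n \<noteq> (y + c) mod n"
    proof
      assume "(x + c) mod n = (y + c) mod n"
      then have "n dvd (y + c) - (x + c)"
        using xy by (metis add_le_mono1 less_imp_le mod_eq_dvd_iff_nat)
      then have "n dvd y - x" by simp
      then show False using xy by (auto dest: dvd_imp_le)
    qed
  qed
  moreover have "(\<lambda>x. (x + c) mod n) ` {..<n} \<subseteq> {..<n}" by auto
  ultimately show ?thesis
    by (simp add: bij_betw_def endo_inj_surj)
qed

text \<open>The shift permutes the residues, so the preimage of \<open>{..<m}\<close> has
  \<open>m\<close> elements. This one count gives the users of a block, the ENs holding a run and
  the runs held by an EN.\<close>

lemma card_cyclic_window:
  fixes c m n :: nat
  assumes "m \<le> n"
  shows "card {x. x < n \<and> (x + c) mod n < m} = m"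
proof -
  have "bij_betw (\<lambda>x. (x + c) mod n) {x. x < n \<and> (x + c) mod n < m} {..<m}"
  proof (rule bij_betw_subset[OF bij_betw_add_mod])
    show "{x. x < n \<and> (x + c) mod n < m} \<subseteq> {..<n}" by auto
    show "(\<lambda>x. (x + c) mod n) ` {x. x < n \<and> (x + c) mod n < m} = {..<m}" (is "?f ` ?A = _")
    proof
      show "{..<m} \<subseteq> ?f ` ?A"
      proof
        fix y assume y: "y \<in> {..<m}"
        then have "y \<in> ?f ` {..<n}"
          using bij_betw_add_mod[of c n] assms by (auto simp: bij_betw_def)
        with y show "y \<in> ?f ` ?A" by auto
      qed
    qed auto
  qed
  then show ?thesis using bij_betw_same_card by fastforce
qed

section \<open>Unit solutions from an invertible submatrix\<close>

text \<open>The rank of \<open>j\<close> in \<open>J\<close> is its index in a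
  \<open>submatrix\<close>, and \<open>pick J\<close> takes the rank back to
  \<open>j\<close>.\<close>

lemma bij_betw_card_less:
  fixes J :: "nat set"
  assumes "finite J"
  shows "bij_betw (\<lambda>j. card {a\<in>J. a < j}) J {..<card J}"
proof -
  have "inj_on (\<lambda>j. card {a\<in>J. a < j}) J"
    by (rule inj_on_inverseI[where g = "pick J"]) (rule pick_card_in_set)
  moreover have "(\<lambda>j. card {a\<in>J. a < j}) ` J \<subseteq> {..<card J}"
    using assms by (auto intro!: psubset_card_mono)
  ultimately show ?thesis
    by (simp add: bij_betw_def card_image card_subset_eq)
qed

text \<open>The solution \<open>w\<close> is the column of the inverse submatrix that belongs to
  \<open>k\<close>, moved to the positions in \<open>J\<close> and padded with zeros. Its equations
  are entries of \<open>M * B = 1\<close>.\<close>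

lemma invertible_submatrix_unit_solution:
  fixes H :: "'a::semiring_1 mat"
  assumes R: "R \<subseteq> {..<dim_row H}" and J: "J \<subseteq> {..<dim_col H}"
    and inv: "invertible_mat (submatrix H R J)" and k: "k \<in> R"
  obtains w where "\<And>j. j \<notin> J \<Longrightarrow> w j = 0"
    and "\<And>l. l \<in> R \<Longrightarrow> (\<Sum>j<dim_col H. H $$ (l, j) * w j) = (if l = k then 1 else 0)"
proof -
  define M where "M = submatrix H R J"
  define pos where "pos S x = card {a\<in>S. a < x}" for S :: "nat set" and x
  have fin: "finite R" "finite J"
    using R J finite_subset by blast+
  have "{i. i < dim_row H \<and> i \<in> R} = R" "{j. j < dim_col H \<and> j \<in> J} = J"
    using R J by auto
  then have dim: "dim_row M = card R" "dim_col M = card J"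
    by (simp_all add: M_def dim_submatrix)
  obtain B where B: "M * B = 1\<^sub>m (dim_row M)" "B * M = 1\<^sub>m (dim_row B)"
    using inv unfolding M_def invertible_mat_def inverts_mat_def by blast
  \<comment> \<open>The shape of \<open>B\<close> is not given in advance; comparing column counts
    in the two identities determines it.\<close>
  have dimB: "dim_col B = card R" "dim_row B = card J"
    using arg_cong[OF B(1), of dim_col] arg_cong[OF B(2), of dim_col] dim by auto
  have bijR: "bij_betw (pos R) R {..<card R}" and bijJ: "bij_betw (pos J) J {..<card J}"
    unfolding pos_def using fin by (auto intro: bij_betw_card_less)
  define w where "w j = (if j \<in> J then B $$ (pos J j, pos R k) else 0)" for j
  have "(\<Sum>j<dim_col H. H $$ (l, j) * w j) = (if l = k then 1 else 0)" if l: "l \<in> R" for l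
  proof -
    have lk: "pos R l < card R" "pos R k < card R"
      using bijR l k by (auto simp: bij_betw_def)
    have "(\<Sum>j<dim_col H. H $$ (l, j) * w j) = (\<Sum>j\<in>J. H $$ (l, j) * w j)"
      using J by (intro sum.mono_neutral_right) (auto simp: w_def)
    also have "\<dots> = (\<Sum>j\<in>J. M $$ (pos R l, pos J j) * B $$ (pos J j, pos R k))"
    proof (rule sum.cong)
      fix j assume j: "j \<in> J"
      have "M $$ (pos R l, pos J j) = H $$ (l, j)"
        unfolding M_def pos_def using R J l j by (intro submatrix_index_card) auto
      then show "H $$ (l, j) * w j = M $$ (pos R l, pos J j) * B $$ (pos J j, pos R k)"
        using j by (simp add: w_def)
    qed simp
    also have "\<dots> = (\<Sum>t<card J. M $$ (pos R l, t) * B $$ (t, pos R k))"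
      by (rule sum.reindex_bij_betw[OF bijJ])
    also have "\<dots> = (M * B) $$ (pos R l, pos R k)"
      using lk dim dimB by (simp add: scalar_prod_def lessThan_atLeast0)
    also have "\<dots> = (if pos R l = pos R k then 1 else 0)"
      using B(1) lk dim by simp
    also have "\<dots> = (if l = k then 1 else 0)"
      using bijR l k by (auto simp: bij_betw_def inj_on_def)
    finally show ?thesis .
  qed
  with that[of w] show ?thesis by (simp add: w_def)
qed

section \<open>Zero-forcing precoders\<close>

context f_ran
begin

text \<open>The ENs in \<open>A\<close> own \<open>card A * n_T\<close> columns of the channel
  matrix, enough to choose one per user in \<open>R\<close>. Non-degeneracy makes this square
  submatrix invertible, and cutting the unit solution into pieces of length \<open>n_T\<close>
  yields the precoders.\<close>

lemma zero_forcing_precoder: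
  assumes h: "h \<in> channels" and R: "R \<subseteq> {..<K_R}" and A: "A \<subseteq> {..<K_T}"
    and card: "card R \<le> card A * n_T" and k: "k \<in> R"
  obtains v where "\<And>i. v i \<in> carrier_vec n_T" and "\<And>i. i \<notin> A \<Longrightarrow> v i = 0\<^sub>v n_T"
    and "\<And>l. l \<in> R \<Longrightarrow> (\<Sum>i<K_T. scalar_prod (h b l i) (v i)) = (if l = k then 1 else 0)"
proof -
  define H where "H = channel_matrix (h b)"
  have dim: "dim_row H = K_R" "dim_col H = K_T * n_T"
    by (simp_all add: H_def channel_matrix_def)
  \<comment> \<open>Antenna \<open>a\<close> of EN \<open>i\<close> is column
    \<open>i * n_T + a\<close>, which inverts the \<open>div\<close>/\<open>mod\<close> decoding in
    \<open>channel_matrix\<close>.\<close>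
  define antennas where "antennas = (\<lambda>(i, a). i * n_T + a) ` (A \<times> {..<n_T})"
  have "inj_on (\<lambda>(i, a). i * n_T + a) (A \<times> {..<n_T})"
    by (rule inj_on_inverseI[where g = "\<lambda>j. (j div n_T, j mod n_T)"]) auto
  then have "card antennas = card A * n_T"
    by (simp add: antennas_def card_image card_cartesian_product)
  then obtain J where J: "J \<subseteq> antennas" "card J = card R"
    using card obtain_subset_with_card_n by metis
  have ant_lt: "i * n_T + a < K_T * n_T" if "i < K_T" "a < n_T" for i a
  proof -
    have "i * n_T + a < Suc i * n_T" using that by simp
    also have "\<dots> \<le> K_T * n_T" using that by (intro mult_right_mono) auto
    finally show ?thesis .
  qed
  then have "antennas \<subseteq> {..<K_T * n_T}"
    using A by (auto simp: antennas_def)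
  then have J_sub: "J \<subseteq> {..<K_T * n_T}" using J by blast
  have "invertible_mat (submatrix H R J)"
    using h R J J_sub unfolding channels_def H_def by auto
  then obtain w where w0: "\<And>j. j \<notin> J \<Longrightarrow> w j = 0"
    and w: "\<And>l. l \<in> R \<Longrightarrow> (\<Sum>j<dim_col H. H $$ (l, j) * w j) = (if l = k then 1 else 0)"
    using invertible_submatrix_unit_solution[of R H J k] R J_sub k dim by metis
  define v where "v i = vec n_T (\<lambda>a. w (i * n_T + a))" for i
  show ?thesis
  proof (rule that)
    show "v i \<in> carrier_vec n_T" for i by (simp add: v_def)
    show "v i = 0\<^sub>v n_T" if i: "i \<notin> A" for i
    proof -
      have "i * n_T + a \<notin> J" if "a < n_T" for a
      proof
        assume "i * n_T + a \<in> J"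
        then obtain i' a' where "i' \<in> A" "a' < n_T" "i * n_T + a = i' * n_T + a'"
          using J by (auto simp: antennas_def)
        then have "i = i'"
          using that by (metis add.commute div_mult_self3 div_less add.right_neutral not_less_zero)
        with i \<open>i' \<in> A\<close> show False by simp
      qed
      then show ?thesis by (auto simp: v_def w0)
    qed
    show "(\<Sum>i<K_T. scalar_prod (h b l i) (v i)) = (if l = k then 1 else 0)" if l: "l \<in> R" for l
    proof -
      have "scalar_prod (h b l i) (v i) = (\<Sum>j\<in>{i*n_T..<i*n_T+n_T}. H $$ (l, j) * w j)"
        if i: "i < K_T" for i
      proof -
        have "H $$ (l, i * n_T + a) = h b l i $ a" if "a < n_T" for a
          using l R i that ant_lt[OF i that] by (auto simp: H_def channel_matrix_def)
        then have "scalar_prod (h b l i) (v i)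
            = (\<Sum>a\<in>{0..<n_T}. H $$ (l, a + i * n_T) * w (a + i * n_T))"
          by (simp add: scalar_prod_def v_def add.commute)
        also have "\<dots> = (\<Sum>j\<in>{i*n_T..<i*n_T+n_T}. H $$ (l, j) * w j)"
          using sum.shift_bounds_nat_ivl[of "\<lambda>j. H $$ (l, j) * w j" 0 "i * n_T" n_T]
          by (simp add: add.commute)
        finally show ?thesis .
      qed
      then show ?thesis
        using w[OF l] dim sum.nat_group[of "\<lambda>j. H $$ (l, j) * w j" n_T K_T] by simp
    qed
  qed
qed

section \<open>Cyclic caching and delivery\<close>

text \<open>The run of packet \<open>p\<close> is \<open>p div u\<close>. The window condition is
  symmetric in run and EN.\<close>

definition cyclic_cache :: "nat \<Rightarrow> nat \<Rightarrow> nat \<Rightarrow> nat \<Rightarrow> packet set" where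
  "cyclic_cache m u i n = {n} \<times> {p. p < K_T * u \<and> (p div u + i) mod K_T < m}"

text \<open>Each EN holds \<open>m\<close> of the \<open>K_T\<close> runs of every file, a fraction
  \<open>m / K_T\<close> \<le> \<mu>.\<close>

lemma valid_cyclic_cache:
  assumes "m \<le> K_T" and "real m \<le> \<mu> * real K_T"
  shows "valid_cache \<mu> (K_T * u) (cyclic_cache m u)"
  unfolding valid_cache_def
proof (intro allI impI conjI)
  fix i n
  show "cyclic_cache m u i n \<subseteq> file_packets (K_T * u) n"
    by (auto simp: cyclic_cache_def file_packets_def)
  have "{p. p < K_T * u \<and> (p div u + i) mod K_T < m}
      \<subseteq> (\<lambda>(q, s). u * q + s) ` ({q. q < K_T \<and> (q + i) mod K_T < m} \<times> {..<u})" (is "?P \<subseteq> ?f ` ?Q")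
  proof
    fix p assume p: "p \<in> ?P"
    then have u: "u > 0" by (cases u) auto
    have "p = ?f (p div u, p mod u)" by simp
    moreover have "(p div u, p mod u) \<in> ?Q"
      using p u by (auto simp: less_mult_imp_div_less)
    ultimately show "p \<in> ?f ` ?Q" by (rule image_eqI)
  qed
  then have "card ?P \<le> card (?f ` ?Q)" by (intro card_mono) auto
  also have "\<dots> \<le> card ?Q" by (rule card_image_le) auto
  also have "\<dots> = m * u" using assms(1) by (simp add: card_cyclic_window)
  finally have "card (cyclic_cache m u i n) \<le> m * u"
    by (simp add: cyclic_cache_def card_cartesian_product)
  then have "real (card (cyclic_cache m u i n)) \<le> real m * real u"
    by (metis of_nat_le_iff of_nat_mult)
  also have "\<dots> \<le> \<mu> * real K_T * real u"
    using assms(2) by (intro mult_right_mono) auto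
  finally show "real (card (cyclic_cache m u i n)) \<le> \<mu> * real (K_T * u)"
    by (simp add: mult.assoc)
qed

lemma cyclic_delivery:
  assumes d: "d \<in> requests" and h: "h \<in> channels"
    and u: "0 < u" "u \<le> K_R" "u \<le> m * n_T" and m: "m \<le> K_T"
  obtains D where "valid_delivery 0 (K_T * u) (cyclic_cache m u) d h D"
    and "blocks D = K_T * K_R"
proof -
  define R where "R b = {k. k < K_R \<and> (k + b) mod K_R < u}" for b
  define A where "A b = {i. i < K_T \<and> (i + b div K_R) mod K_T < m}" for b
  \<comment> \<open>Block \<open>b\<close> handles run \<open>b div K_R\<close>. The position of a
    served user in the window, a number below \<open>u\<close>, doubles as the index of its packet
    within the run.\<close>
  define pkt where "pkt b k = u * (b div K_R) + (k + b) mod K_R" for b k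
  define zf where "zf b k v \<longleftrightarrow>
      (\<forall>i. v i \<in> carrier_vec n_T) \<and> (\<forall>i. i \<notin> A b \<longrightarrow> v i = 0\<^sub>v n_T) \<and>
      (\<forall>l\<in>R b. (\<Sum>i<K_T. scalar_prod (h b l i) (v i)) = (if l = k then 1 else 0))" for b k v
  have zf_ex: "\<exists>v. zf b k v" if k: "k \<in> R b" for b k
  proof -
    have "R b \<subseteq> {..<K_R}" "A b \<subseteq> {..<K_T}" by (auto simp: R_def A_def)
    moreover have "card (R b) \<le> card (A b) * n_T"
      using u m by (simp add: R_def A_def card_cyclic_window)
    ultimately show ?thesis
    proof (rule zero_forcing_precoder[OF h _ _ _ k, of "A b" b])
      fix v
      assume "\<And>i. v i \<in> carrier_vec n_T" "\<And>i. i \<notin> A b \<Longrightarrow> v i = 0\<^sub>v n_T"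
        "\<And>l. l \<in> R b \<Longrightarrow> (\<Sum>i<K_T. scalar_prod (h b l i) (v i)) = (if l = k then 1 else 0)"
      then have "zf b k v" unfolding zf_def by blast
      then show ?thesis by blast
    qed
  qed
  \<comment> \<open>For users outside \<open>R b\<close> the value is arbitrary;
    \<open>valid_delivery\<close> constrains only served users.\<close>
  define V where "V b k = (SOME v. zf b k v)" for b k
  have V_zf: "zf b k (V b k)" if "k \<in> R b" for b k
    unfolding V_def using zf_ex[OF that] by (rule someI_ex)
  have V: "V b k i \<in> carrier_vec n_T"
      "i \<notin> A b \<Longrightarrow> V b k i = 0\<^sub>v n_T"
      "l \<in> R b \<Longrightarrow> (\<Sum>i<K_T. scalar_prod (h b l i) (V b k i)) = (if l = k then 1 else 0)"
    if "k \<in> R b" for b k i l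
    using V_zf[OF that] by (auto simp: zf_def)
  define D where "D = \<lparr>fronthaul = \<lambda>_. {}, blocks = K_T * K_R, served = R,
    sent = \<lambda>b k. (d k, pkt b k), precoder = \<lambda>b i k. V b k i\<rparr>"
  have d_lt: "d k < N" if "k < K_R" for k
    using d that by (auto simp: requests_def PiE_iff)
  have pkt_lt: "pkt b k < K_T * u" and pkt_div: "pkt b k div u = b div K_R"
    if "b < K_T * K_R" "k \<in> R b" for b k
  proof -
    have s: "(k + b) mod K_R < u" using that by (simp add: R_def)
    then show div: "pkt b k div u = b div K_R" using u by (simp add: pkt_def)
    have "b div K_R < K_T" using that by (simp add: less_mult_imp_div_less)
    then have "pkt b k div u < K_T" by (simp add: div)
    then show "pkt b k < K_T * u" using u by (simp add: div_less_iff_less_mult)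
  qed
  have "valid_delivery 0 (K_T * u) (cyclic_cache m u) d h D"
    unfolding valid_delivery_def
  proof (intro conjI allI impI ballI)
    fix b k assume b: "b < blocks D" and "k \<in> served D b"
    then have k: "k \<in> R b" and b: "b < K_T * K_R" by (auto simp: D_def)
    then have kR: "k < K_R" by (simp add: R_def)
    show "sent D b k \<in> file_packets (K_T * u) (d k)"
      using pkt_lt[OF b k] by (simp add: D_def file_packets_def)
    show "precoder D b i k \<in> carrier_vec n_T" for i
      using V(1)[OF k] by (simp add: D_def)
    show "precoder D b i k = 0\<^sub>v n_T"
      if "i < K_T" "sent D b k \<notin> available (cyclic_cache m u) D i" for i
    proof -
      \<comment> \<open>By contraposition: an EN in \<open>A b\<close> caches all of run
        \<open>b div K_R\<close>, hence the packet sent.\<close>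
      have "i \<notin> A b"
        using that pkt_lt[OF b k] pkt_div[OF b k] d_lt[OF kR]
        by (auto simp: A_def D_def available_def cyclic_cache_def add.commute)
      then show ?thesis using V(2)[OF k] by (simp add: D_def)
    qed
    show "(\<Sum>i<K_T. scalar_prod (h b k i) (precoder D b i k)) \<noteq> 0"
      using V(3)[OF k k] by (simp add: D_def)
    show "(\<Sum>i<K_T. scalar_prod (h b l i) (precoder D b i k)) = 0" if "l \<in> served D b - {k}" for l
      using V(3)[OF k, of l] that by (simp add: D_def)
  next
    fix k p assume k: "k < K_R" and p: "p \<in> file_packets (K_T * u) (d k)"
    then obtain f where f: "p = (d k, f)" "f < K_T * u" by (auto simp: file_packets_def)
    define q s where "q = f div u" and "s = f mod u"
    have "q < K_T" "s < u" using f u by (auto simp: q_def s_def less_mult_imp_div_less)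
    then have "s \<in> (\<lambda>x. (x + k) mod K_R) ` {..<K_R}"
      using u by (simp add: bij_betw_imp_surj_on[OF bij_betw_add_mod])
    then obtain b' where b': "b' < K_R" "(b' + k) mod K_R = s"
      by auto
    \<comment> \<open>Run \<open>q\<close> fixes the quotient of the block index; the remainder
      \<open>b'\<close> brings user \<open>k\<close> to window position \<open>s\<close>.\<close>
    define b where "b = K_R * q + b'"
    have "k + b = b' + k + K_R * q" by (simp add: b_def)
    then have "(k + b) mod K_R = s" using b' by (metis mod_mult_self2)
    moreover have "b div K_R = q" using b' by (simp add: b_def)
    ultimately have bq: "b div K_R = q" "(k + b) mod K_R = s" by simp_all
    have "b div K_R < K_T" using bq \<open>q < K_T\<close> by simp
    then have "b < K_T * K_R" using k by (simp add: div_less_iff_less_mult)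
    moreover have "k \<in> R b" using k bq \<open>s < u\<close> by (simp add: R_def)
    moreover have "pkt b k = f" by (simp add: pkt_def bq q_def s_def)
    ultimately show "\<exists>b<blocks D. k \<in> served D b \<and> sent D b k = p"
      using f by (auto simp: D_def)
  qed (auto simp: D_def R_def)
  then show ?thesis using that by (simp add: D_def)
qed

section \<open>From the scheme to the NDT bound\<close>

lemma NDT_bar_zero_le:
  assumes "0 < m" "m \<le> K_T" "real m \<le> \<mu> * real K_T" "0 < n_T" "0 < K_R"
  shows "NDT_bar \<mu> 0 \<le> ereal (delta_E m)"
proof -
  define u where "u = users_per_block m"
  have u: "0 < u" "u \<le> K_R" "u \<le> m * n_T"
    using assms by (auto simp: u_def users_per_block_def)
  \<comment> \<open>With the hypotheses inside the existential, choice yields a total function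
    \<open>del\<close>, as a policy requires.\<close>
  have "\<exists>D. d \<in> requests \<and> h \<in> channels \<longrightarrow>
      valid_delivery 0 (K_T * u) (cyclic_cache m u) d h D \<and> blocks D = K_T * K_R" for d h
    using cyclic_delivery[OF _ _ u assms(2), of d h] by metis
  then obtain del where del: "\<And>d h. d \<in> requests \<Longrightarrow> h \<in> channels \<Longrightarrow>
      valid_delivery 0 (K_T * u) (cyclic_cache m u) d h (del d h) \<and> blocks (del d h) = K_T * K_R"
    by metis
  define P where "P = \<lparr>packets_per_file = K_T * u, cache = cyclic_cache m u, deliver = del\<rparr>"
  have "valid_policy \<mu> 0 P"
    using valid_cyclic_cache[OF assms(2,3)] del u assms
    by (auto simp: valid_policy_def P_def Suc_le_eq)
  then have "NDT_bar \<mu> 0 \<le> policy_NDT 0 P"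
    unfolding NDT_bar_def by (intro INF_lower) simp
  also have "policy_NDT 0 P \<le> ereal (delta_E m)"
    unfolding policy_NDT_def
  proof (intro SUP_least)
    fix d h assume "d \<in> requests" "h \<in> channels"
    then have "blocks (del d h) = K_T * K_R" using del by blast
    then show "ereal (fronthaul_NDT 0 (packets_per_file P) (deliver P d h) +
        edge_NDT (packets_per_file P) (deliver P d h)) \<le> ereal (delta_E m)"
      using assms by (simp add: P_def fronthaul_NDT_def edge_NDT_def delta_E_def u_def)
  qed
  finally show ?thesis .
qed

end

text \<open>The epigraph is contained in its convex hull, so a bound on \<open>f\<close> at
  \<open>x\<close> passes to the envelope.\<close>

lemma lower_convex_envelope_le:
  assumes "x \<in> S" "f x \<le> ereal z"
  shows "lower_convex_envelope S f x \<le> ereal z"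
proof -
  have "(x, z) \<in> convex hull {(a, z). a \<in> S \<and> f a \<le> ereal z}"
    using assms by (intro hull_inc) simp
  then show ?thesis
    unfolding lower_convex_envelope_def by (intro INF_lower) simp
qed

theorem proposition1:
  fixes K_T K_R n_T N :: nat and \<mu> :: real
  assumes "K_T \<ge> 1" and "K_R \<ge> 1" and "n_T \<ge> 1" and "N \<ge> K_R"
    and "1 / real K_T \<le> \<mu>" and "\<mu> \<le> 1"
  shows "f_ran.min_NDT K_T K_R n_T N \<mu> 0
           \<le> ereal (f_ran.delta_E K_R n_T (f_ran.multiplicity_at K_T K_R n_T \<mu>))"
proof -
  interpret f_ran K_T K_R n_T N .
  define m where "m = multiplicity_at \<mu>"
  have one: "1 \<le> \<mu> * real K_T"
    using assms by (simp add: field_simps)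
  \<comment> \<open>Here \<mu> \<ge> \<open>1 / K_T\<close> makes the floor at least 1, and
    \<open>m_max\<close> is positive because \<open>K_T\<close>, \<open>K_R\<close> and
    \<open>n_T\<close> are.\<close>
  have "0 < m"
    using one assms by (simp add: m_def multiplicity_at_def m_max_def)
  moreover have "m \<le> K_T"
    by (simp add: m_def multiplicity_at_def m_max_def)
  moreover have "real m \<le> \<mu> * real K_T"
  proof -
    have "m \<le> nat \<lfloor>\<mu> * real K_T\<rfloor>" by (simp add: m_def multiplicity_at_def)
    then show ?thesis using one by linarith
  qed
  ultimately have "NDT_bar \<mu> 0 \<le> ereal (delta_E m)"
    using assms by (intro NDT_bar_zero_le) auto
  moreover have "0 \<le> \<mu>"
    using assms(5) by (rule order_trans[rotated]) simp
  ultimately show ?thesis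
    using assms(6) unfolding min_NDT_def m_def by (intro lower_convex_envelope_le) auto
qed

end
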